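(* Let $s(n,k)$ be the number of partial packing paths with $n$ steps ending at height $k$. The matrices $\mathcal S_e=[s(n+k,2k)]_{n,k\ge0}$ and $\mathcal S_o=[s(n+k+1,2k+1)]_{n,k\ge0}$ are Riordan arrays. More precisely, with $p(x)=1-2x+x^2-4x^3+4x^4$, $$\mathcal S_e=\left(\frac{1-x-\sqrt{p(x)}}{2x^3},\ \frac{1-x^2(1+2x)-(1+x)\sqrt{p(x)}}{2x^3}\right)$$ and $$\mathcal S_o=\left(\frac{1-3x^3-2x^4-(1+x+x^2)\sqrt{p(x)}}{2x^5},\ \frac{1-x^2-2x^3-(1+x)\sqrt{p(x)}}{2x^3}\right).$$
   Context: A Riordan array $(g(x),f(x))$, for formal power series with $g(0)\ne0$, $f(0)=0$, $f'(0)\neq0$, is the infinite lower triangular matrix whose $k$-th column ($k\ge0$) has generating function $g(x)f(x)^k$, i.e. its $(n,k)$ entry is $[x^n]g(x)f(x)^k$. Consider the hexagonal packing of the plane by circles of radius $2$ with centers $(2+4i+2j,\,2\sqrt3\,j)$, $i,j\in\mathbb Z$; the origin is the tangency point of two horizontally adjacent circles. The tangency points cut every circle into six arcs. Traversed from left to right these give six types of steps (angles measured on the circle carrying the arc): $U$ from $180^\circ$ to $120^\circ$ (displacement $(1,\sqrt3)$), $F$ from $120^\circ$ to $60^\circ$ (displacement $(2,0)$), $D$ from $60^\circ$ to $0^\circ$ (displacement $(1,-\sqrt3)$), $\overline U$ from $300^\circ$ to $360^\circ$ (displacement $(1,\sqrt3)$), $\overline F$ from $240^\circ$ to $300^\circ$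 (displacement $(2,0)$), $\overline D$ from $180^\circ$ to $240^\circ$ (displacement $(1,-\sqrt3)$). A path in the packing starts at the origin, is a concatenation of such arcs of circles of the packing, each starting where the previous one ends, and stays in the quarter plane $x,y\ge 0$. Equivalently, it is a word in $\{U,F,D,\overline U,\overline F,\overline D\}$ whose first step (if any) is $U$, in which $U$ or $\overline F$ can only be followed by $F$ or $\overline U$; $F$ or $\overline D$ only by $\overline F$ or $D$; $\overline U$ or $D$ only by $U$ or $\overline D$; and which never goes below ordinate $0$. A packing path is such a path ending on the $x$-axis; a partial packing path is any prefix of a packing path. The empty path is allowed. The number of steps of a path is its number of arcs. The (final) height of a path is the integer $k$ such that its endpoint has ordinate $k\sqrt3$. The square root denotes the formal power series with constant term $1$. *)

theory Defs
  imports Complex_Main "HOL-Computational_Algebra.Formal_Power_Series"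
begin

section \<open>Riordan arrays\<close>

definition riordan_array :: "'a::field fps \<Rightarrow> 'a fps \<Rightarrow> nat \<Rightarrow> nat \<Rightarrow> 'a" where
  "riordan_array g f n k = fps_nth (g * f ^ k) n"

definition is_riordan_array :: "(nat \<Rightarrow> nat \<Rightarrow> 'a::field) \<Rightarrow> 'a fps \<Rightarrow> 'a fps \<Rightarrow> bool" where
  "is_riordan_array M g f \<longleftrightarrow>
     fps_nth g 0 \<noteq> 0 \<and> fps_nth f 0 = 0 \<and> fps_nth f 1 \<noteq> 0 \<and> M = riordan_array g f"

text \<open>On \<open>real fps\<close>, \<open>fps_radical root 2 p\<close> with \<open>p $ 0 = 1\<close> is the square root of \<open>p\<close> with
  constant term 1.  Division of power series by \<open>2 * fps_X ^ m\<close> discards the terms of order below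
  \<open>m\<close>; it is only used on numerators of order at least \<open>m\<close>, where it is exact.\<close>

section \<open>Paths in the hexagonal circle packing\<close>

text \<open>The plane is identified with the complex numbers.
  \<open>Ub\<close>, \<open>Fb\<close>, \<open>Db\<close> are the barred steps, which run along the lower half of a circle.\<close>

datatype step = U | F | D | Ub | Fb | Db

definition center :: "int \<Rightarrow> int \<Rightarrow> complex" where
  "center i j = Complex (2 + 4 * real_of_int i + 2 * real_of_int j) (2 * sqrt 3 * real_of_int j)"

fun start_angle :: "step \<Rightarrow> real" where
  "start_angle U = pi"
| "start_angle F = 2 * pi / 3"
| "start_angle D = pi / 3"
| "start_angle Ub = 5 * pi / 3"
| "start_angle Fb = 4 * pi / 3"
| "start_angle Db = pi"

fun end_angle :: "step \<Rightarrow> real" where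
  "end_angle U = 2 * pi / 3"
| "end_angle F = pi / 3"
| "end_angle D = 0"
| "end_angle Ub = 2 * pi"
| "end_angle Fb = 5 * pi / 3"
| "end_angle Db = 4 * pi / 3"

text \<open>The arc \<open>(i, j, s)\<close> is the arc of type \<open>s\<close> on the circle of radius 2 about \<open>center i j\<close>.\<close>

type_synonym arc = "int \<times> int \<times> step"

fun arc_point :: "arc \<Rightarrow> real \<Rightarrow> complex" where
  "arc_point (i, j, s) t = center i j + 2 * cis t"

fun arc_start :: "arc \<Rightarrow> complex" where
  "arc_start (i, j, s) = arc_point (i, j, s) (start_angle s)"

fun arc_end :: "arc \<Rightarrow> complex" where
  "arc_end (i, j, s) = arc_point (i, j, s) (end_angle s)"

text \<open>Upper arcs are traversed clockwise, so their start angle is the larger one.\<close>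

fun arc_points :: "arc \<Rightarrow> complex set" where
  "arc_points (i, j, s) =
     arc_point (i, j, s) ` {min (start_angle s) (end_angle s)..max (start_angle s) (end_angle s)}"

fun consecutive_from :: "complex \<Rightarrow> arc list \<Rightarrow> bool" where
  "consecutive_from z [] \<longleftrightarrow> True"
| "consecutive_from z (a # as) \<longleftrightarrow> arc_start a = z \<and> consecutive_from (arc_end a) as"

definition is_path :: "arc list \<Rightarrow> bool" where
  "is_path P \<longleftrightarrow>
     consecutive_from 0 P \<and> (\<forall>a\<in>set P. arc_points a \<subseteq> {z. Re z \<ge> 0 \<and> Im z \<ge> 0})"

definition endpoint :: "arc list \<Rightarrow> complex" where
  "endpoint P = (if P = [] then 0 else arc_end (last P))"

definition packing_path :: "arc list \<Rightarrow> bool" where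
  "packing_path P \<longleftrightarrow> is_path P \<and> Im (endpoint P) = 0"

definition partial_packing_path :: "arc list \<Rightarrow> bool" where
  "partial_packing_path P \<longleftrightarrow> (\<exists>Q. packing_path (P @ Q))"

text \<open>Number of partial packing paths with \<open>n\<close> steps ending at height \<open>k\<close>.  The start of an arc
  together with its type determines its circle, so the set is finite and \<open>card\<close> is a true count.\<close>

definition num_partial :: "nat \<Rightarrow> nat \<Rightarrow> nat" where
  "num_partial n k = card {P. partial_packing_path P \<and> length P = n \<and> Im (endpoint P) = real k * sqrt 3}"

definition S_even :: "nat \<Rightarrow> nat \<Rightarrow> real" where
  "S_even n k = real (num_partial (n + k) (2 * k))"

definition S_odd :: "nat \<Rightarrow> nat \<Rightarrow> real" where
  "S_odd n k = real (num_partial (n + k + 1) (2 * k + 1))"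

end

theory Submission imports Defs begin

text \<open>
  Every path can be continued down to the axis, so partial packing paths are all the paths, and deleting the last
  arc gives linear recurrences for their numbers by length and kind of final vertex. The kind
  \<open>West\<close> occurs exactly at even heights, the kinds \<open>NW\<close> and \<open>NE\<close> at odd ones; let
  \<open>A\<^sub>k\<close>, \<open>B\<^sub>k\<close>, \<open>C\<^sub>k\<close> be the generating functions at heights \<open>2k\<close>, \<open>2k+1\<close>, \<open>2k+1\<close>. The recurrences
  have a unique solution, and the ansatz \<open>\<alpha> h\<^sup>k\<close>, \<open>\<beta> h\<^sup>k\<close>, \<open>\<gamma> h\<^sup>k\<close> solves them when \<open>h = X \<beta>\<close> and
  \<open>X\<^sup>3 \<alpha>\<^sup>2 + (X - 1) \<alpha> + (1 - X) = 0\<close>, a quadratic of discriminant \<open>p\<close>.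
\<close>

unbundle fps_syntax

section \<open>Vertices of the packing\<close>

text \<open>The vertex \<open>(i, j, w)\<close> is the point of the circle about \<open>center i j\<close> at angle 180, 120 or 60
  degrees, for \<open>w\<close> being \<open>West\<close>, \<open>NW\<close>, \<open>NE\<close>; each tangency point arises exactly once.\<close>

datatype spot = West | NW | NE

type_synonym vertex = "int \<times> int \<times> spot"

fun abscissa :: "vertex \<Rightarrow> int" where
  "abscissa (i, j, West) = 4 * i + 2 * j"
| "abscissa (i, j, NW) = 4 * i + 2 * j + 1"
| "abscissa (i, j, NE) = 4 * i + 2 * j + 3"

fun height :: "vertex \<Rightarrow> int" where
  "height (i, j, West) = 2 * j"
| "height (i, j, NW) = 2 * j + 1"
| "height (i, j, NE) = 2 * j + 1"

definition pos :: "vertex \<Rightarrow> complex" where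
  "pos v = Complex (of_int (abscissa v)) (of_int (height v) * sqrt 3)"

text \<open>Here and in \<open>tgt\<close>, points at 0, 240 and 300 degrees are renamed as the
  \<open>West\<close>, \<open>NE\<close> and \<open>NW\<close> points of the neighbouring circles
  \<open>(i + 1, j)\<close>, \<open>(i, j - 1)\<close> and \<open>(i + 1, j - 1)\<close>, so that
  touching arcs share a vertex literally.\<close>

fun src :: "arc \<Rightarrow> vertex" where
  "src (i, j, U) = (i, j, West)"
| "src (i, j, F) = (i, j, NW)"
| "src (i, j, D) = (i, j, NE)"
| "src (i, j, Ub) = (i + 1, j - 1, NW)"
| "src (i, j, Fb) = (i, j - 1, NE)"
| "src (i, j, Db) = (i, j, West)"

fun tgt :: "arc \<Rightarrow> vertex" where
  "tgt (i, j, U) = (i, j, NW)"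
| "tgt (i, j, F) = (i, j, NE)"
| "tgt (i, j, D) = (i + 1, j, West)"
| "tgt (i, j, Ub) = (i + 1, j, West)"
| "tgt (i, j, Fb) = (i + 1, j - 1, NW)"
| "tgt (i, j, Db) = (i, j - 1, NE)"

text \<open>The parity of the height separates \<open>West\<close> from the other kinds; at a given
  odd height the abscissa modulo 4 separates \<open>NW\<close> from \<open>NE\<close>.\<close>

lemma vertex_eqI:
  assumes "abscissa v = abscissa w" "height v = height w"
  shows "v = w"
proof -
  obtain i j s i' j' s' where "v = (i, j, s)" "w = (i', j', s')"
    by (metis prod_cases3)
  with assms show ?thesis
    by (cases s; cases s') (simp_all; presburger)+
qed

lemma pos_eq_iff: "pos v = pos w \<longleftrightarrow> v = w"
  by (auto simp: pos_def intro: vertex_eqI)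

lemma cis_sixths:
  "cis (pi / 3) = Complex (1 / 2) (sqrt 3 / 2)"
  "cis (2 * pi / 3) = Complex (- 1 / 2) (sqrt 3 / 2)"
  "cis (4 * pi / 3) = Complex (- 1 / 2) (- sqrt 3 / 2)"
  "cis (5 * pi / 3) = Complex (1 / 2) (- sqrt 3 / 2)"
proof -
  show 1: "cis (pi / 3) = Complex (1 / 2) (sqrt 3 / 2)"
    by (simp add: cis.code cos_60 sin_60)
  have "cis (2 * pi / 3) = cis pi * cnj (cis (pi / 3))"
    unfolding cis_cnj cis_mult by (simp add: field_simps)
  then show "cis (2 * pi / 3) = Complex (- 1 / 2) (sqrt 3 / 2)"
    by (simp add: 1 complex_eq_iff)
  have "cis (4 * pi / 3) = cis pi * cis (pi / 3)"
    unfolding cis_mult by (simp add: field_simps)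
  then show "cis (4 * pi / 3) = Complex (- 1 / 2) (- sqrt 3 / 2)"
    by (simp add: 1 complex_eq_iff)
  have "cis (5 * pi / 3) = cis (2 * pi) * cnj (cis (pi / 3))"
    unfolding cis_cnj cis_mult by (simp add: field_simps)
  then show "cis (5 * pi / 3) = Complex (1 / 2) (- sqrt 3 / 2)"
    by (simp add: 1 complex_eq_iff)
qed

lemma arc_start_eq: "arc_start a = pos (src a)"
proof -
  obtain i j s where "a = (i, j, s)" by (metis prod_cases3)
  then show ?thesis
    by (cases s; simp only: arc_start.simps arc_point.simps start_angle.simps cis_sixths cis_pi cis_zero cis_2pi;
        simp add: pos_def center_def complex_eq_iff algebra_simps)
qed

lemma arc_end_eq: "arc_end a = pos (tgt a)"
proof -
  obtain i j s where "a = (i, j, s)" by (metis prod_cases3)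
  then show ?thesis
    by (cases s; simp only: arc_end.simps arc_point.simps end_angle.simps cis_sixths cis_pi cis_zero cis_2pi;
        simp add: pos_def center_def complex_eq_iff algebra_simps)
qed

section \<open>Arcs inside the quarter plane\<close>

lemma pos_in_quadrant_iff:
  "pos v \<in> {z. Re z \<ge> 0 \<and> Im z \<ge> 0} \<longleftrightarrow> abscissa v \<ge> 0 \<and> height v \<ge> 0"
  by (simp add: pos_def zero_le_mult_iff)

lemma arc_start_in_points: "arc_start a \<in> arc_points a"
  by (cases a) auto

lemma arc_end_in_points: "arc_end a \<in> arc_points a"
  by (cases a) auto

abbreviation upper :: "step \<Rightarrow> bool" where
  "upper s \<equiv> s \<in> {U, F, D}"

lemma arc_angle_bounds:
  assumes "t \<in> {min (start_angle s) (end_angle s)..max (start_angle s) (end_angle s)}"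
  shows "if upper s then 0 \<le> t \<and> t \<le> start_angle s \<and> start_angle s \<le> pi
         else pi \<le> start_angle s \<and> start_angle s \<le> t \<and> t \<le> 2 * pi"
  using assms pi_gt_zero by (cases s) (auto simp: min_def max_def split: if_splits)

text \<open>Arcs run from left to right: cosine decreases on \<open>[0, pi]\<close>, and lower arcs
  are brought there by reflecting \<open>t\<close> to \<open>2 * pi - t\<close>.\<close>

lemma arc_Re_ge_start:
  assumes "t \<in> {min (start_angle s) (end_angle s)..max (start_angle s) (end_angle s)}"
  shows "cos (start_angle s) \<le> cos t"
proof (cases "upper s")
  case True
  then show ?thesis
    using arc_angle_bounds[OF assms] by (intro cos_monotone_0_pi_le) auto
next
  case False
  have "cos (2 * pi - start_angle s) \<le> cos (2 * pi - t)"
    using arc_angle_bounds[OF assms] False by (intro cos_monotone_0_pi_le) auto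
  then show ?thesis by (simp add: cos_diff)
qed

text \<open>Makes the condition discrete. The start is the leftmost point, upper arcs never dip
  below their centre, and lower arcs dip at most 2 below a centre of ordinate at least
  \<open>2 * sqrt 3\<close>.\<close>

lemma arc_in_quadrant_iff:
  "arc_points a \<subseteq> {z. Re z \<ge> 0 \<and> Im z \<ge> 0} \<longleftrightarrow>
     abscissa (src a) \<ge> 0 \<and> height (src a) \<ge> 0 \<and> height (tgt a) \<ge> 0"
proof
  assume "arc_points a \<subseteq> {z. Re z \<ge> 0 \<and> Im z \<ge> 0}"
  then have "pos (src a) \<in> {z. Re z \<ge> 0 \<and> Im z \<ge> 0}" "pos (tgt a) \<in> {z. Re z \<ge> 0 \<and> Im z \<ge> 0}"
    using arc_start_in_points arc_end_in_points unfolding arc_start_eq arc_end_eq by blast+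
  then show "abscissa (src a) \<ge> 0 \<and> height (src a) \<ge> 0 \<and> height (tgt a) \<ge> 0"
    unfolding pos_in_quadrant_iff by blast
next
  assume *: "abscissa (src a) \<ge> 0 \<and> height (src a) \<ge> 0 \<and> height (tgt a) \<ge> 0"
  obtain i j s where a: "a = (i, j, s)" by (metis prod_cases3)
  \<comment> \<open>A lower arc has an end of odd height \<open>2 * j - 1\<close>, and this is
    nonnegative only if \<open>j \<ge> 1\<close>.\<close>
  have j: "if upper s then j \<ge> 0 else j \<ge> 1"
    using * unfolding a by (cases s) auto
  have start: "0 \<le> Re (center i j) + 2 * cos (start_angle s)"
  proof -
    have "0 \<le> Re (pos (src a))" using * by (simp add: pos_def)
    then show ?thesis unfolding arc_start_eq[symmetric] a by simp
  qed
  show "arc_points a \<subseteq> {z. Re z \<ge> 0 \<and> Im z \<ge> 0}"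
  proof
    fix z assume "z \<in> arc_points a"
    then obtain t where
      t: "t \<in> {min (start_angle s) (end_angle s)..max (start_angle s) (end_angle s)}"
      and z: "z = center i j + 2 * cis t"
      unfolding a by auto
    have "Re z \<ge> 0" using arc_Re_ge_start[OF t] start by (simp add: z)
    moreover have "Im z \<ge> 0"
    proof (cases "upper s")
      case True
      then have "0 \<le> sin t" "0 \<le> j"
        using arc_angle_bounds[OF t] j by (auto intro: sin_ge_zero)
      then show ?thesis by (simp add: z center_def)
    next
      case False
      then have "1 \<le> real_of_int j" using j by auto
      then have "1 * 1 \<le> sqrt 3 * real_of_int j" by (intro mult_mono) auto
      then have "2 \<le> 2 * sqrt 3 * real_of_int j" by simp
      moreover have "Im z = 2 * sqrt 3 * real_of_int j + 2 * sin t" by (simp add: z center_def)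
      ultimately show ?thesis using sin_ge_minus_one[of t] by linarith
    qed
    ultimately show "z \<in> {z. Re z \<ge> 0 \<and> Im z \<ge> 0}" by simp
  qed
qed

section \<open>Extending paths by one step\<close>

definition final :: "arc list \<Rightarrow> vertex" where
  "final P = (if P = [] then (0, 0, West) else tgt (last P))"

lemma final_Nil [simp]: "final [] = (0, 0, West)"
  by (simp add: final_def)

lemma final_snoc [simp]: "final (P @ [a]) = tgt a"
  by (simp add: final_def)

lemma endpoint_eq: "endpoint P = pos (final P)"
  by (simp add: endpoint_def final_def arc_end_eq pos_def complex_eq_iff)

lemma consecutive_from_snoc:
  "consecutive_from z (P @ [a]) \<longleftrightarrow>
     consecutive_from z P \<and> arc_start a = (if P = [] then z else arc_end (last P))"
  by (induction P arbitrary: z) auto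

lemma is_path_Nil [simp]: "is_path []"
  by (simp add: is_path_def)

lemma is_path_final_in_quadrant:
  assumes "is_path P"
  shows "abscissa (final P) \<ge> 0" "height (final P) \<ge> 0"
proof -
  have "pos (final P) \<in> {z. Re z \<ge> 0 \<and> Im z \<ge> 0}"
  proof (cases "P = []")
    case False
    then have "arc_points (last P) \<subseteq> {z. Re z \<ge> 0 \<and> Im z \<ge> 0}"
      using assms by (auto simp: is_path_def)
    then show ?thesis
      using arc_end_in_points[of "last P"] False by (auto simp: final_def arc_end_eq)
  qed (simp add: pos_def)
  then show "abscissa (final P) \<ge> 0" "height (final P) \<ge> 0"
    unfolding pos_in_quadrant_iff by auto
qed

text \<open>The new arc starts at a vertex already in the quadrant and moves right, so only the
  height of its target has to be tested.\<close>

lemma is_path_snoc: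
  "is_path (P @ [a]) \<longleftrightarrow> is_path P \<and> src a = final P \<and> height (tgt a) \<ge> 0"
proof -
  have "is_path (P @ [a]) \<longleftrightarrow>
      is_path P \<and> arc_start a = endpoint P \<and> arc_points a \<subseteq> {z. Re z \<ge> 0 \<and> Im z \<ge> 0}"
    by (auto simp: is_path_def consecutive_from_snoc endpoint_def)
  also have "\<dots> \<longleftrightarrow> is_path P \<and> src a = final P \<and> height (tgt a) \<ge> 0"
    unfolding arc_start_eq endpoint_eq pos_eq_iff arc_in_quadrant_iff
    using is_path_final_in_quadrant[of P] by auto
  finally show ?thesis .
qed

section \<open>Steps as moves between kinds of vertices and rows\<close>

fun src_spot :: "step \<Rightarrow> spot" where
  "src_spot U = West"
| "src_spot F = NW"
| "src_spot D = NE"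
| "src_spot Ub = NW"
| "src_spot Fb = NE"
| "src_spot Db = West"

fun tgt_spot :: "step \<Rightarrow> spot" where
  "tgt_spot U = NW"
| "tgt_spot F = NE"
| "tgt_spot D = West"
| "tgt_spot Ub = West"
| "tgt_spot Fb = NW"
| "tgt_spot Db = NE"

text \<open>The steps \<open>U\<close> and \<open>D\<close> change the height but not the row, since
  both their ends are named after circles of the same row.\<close>

fun row_shift :: "step \<Rightarrow> int" where
  "row_shift Ub = 1"
| "row_shift Db = -1"
| "row_shift _ = 0"

fun arc_from :: "vertex \<Rightarrow> step \<Rightarrow> arc" where
  "arc_from (i, j, w) Ub = (i - 1, j + 1, Ub)"
| "arc_from (i, j, w) Fb = (i, j + 1, Fb)"
| "arc_from (i, j, w) s = (i, j, s)"

definition row :: "vertex \<Rightarrow> int" where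
  "row v = fst (snd v)"

definition spot_of :: "vertex \<Rightarrow> spot" where
  "spot_of v = snd (snd v)"

text \<open>A vertex and a step type determine the circle, and \<open>arc_from\<close> computes it;
  a path is thus determined by its word of steps.\<close>

lemma src_eq_iff:
  "src a = v \<longleftrightarrow> (\<exists>s. spot_of v = src_spot s \<and> a = arc_from v s)"
proof -
  obtain i j s where a: "a = (i, j, s)" by (metis prod_cases3)
  obtain i' j' w where v: "v = (i', j', w)" by (metis prod_cases3)
  show ?thesis
  proof
    assume "src a = v"
    then have "spot_of v = src_spot s \<and> a = arc_from v s"
      unfolding a v by (cases s) (auto simp: spot_of_def)
    then show "\<exists>s. spot_of v = src_spot s \<and> a = arc_from v s" by blast
  next
    assume "\<exists>s. spot_of v = src_spot s \<and> a = arc_from v s"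
    then obtain s' where "spot_of v = src_spot s'" "a = arc_from v s'" by blast
    then show "src a = v"
      unfolding v by (cases s') (auto simp: spot_of_def)
  qed
qed

lemma tgt_arc_from:
  shows "spot_of (tgt (arc_from v s)) = tgt_spot s"
    and "row (tgt (arc_from v s)) = row v + row_shift s"
  by (cases v; cases s; simp add: spot_of_def row_def)+

lemma arc_from_step: "snd (snd (arc_from v s)) = s"
  by (cases v; cases s; simp)

lemma height_eq: "height v = 2 * row v + (if spot_of v = West then 0 else 1)"
  by (cases v rule: height.cases) (auto simp: row_def spot_of_def)

lemma height_nonneg_iff: "height v \<ge> 0 \<longleftrightarrow> row v \<ge> 0"
  unfolding height_eq by auto

lemma is_path_extend:
  assumes "is_path P" "spot_of (final P) = src_spot s" "row (final P) + row_shift s \<ge> 0"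
  shows "is_path (P @ [arc_from (final P) s])"
  using assms by (auto simp: is_path_snoc src_eq_iff height_nonneg_iff tgt_arc_from)

text \<open>From \<open>NE\<close>, the steps \<open>D\<close>, \<open>Db\<close> lead back to
  \<open>NE\<close> one row lower, and in row 0 a single \<open>D\<close> reaches the axis. Any
  other vertex off the axis reaches \<open>NE\<close> by one step, \<open>F\<close> or
  \<open>Db\<close>.\<close>

lemma is_path_extends_to_axis:
  assumes "is_path P"
  shows "\<exists>Q. is_path (P @ Q) \<and> height (final (P @ Q)) = 0"
proof -
  have ne: "\<exists>Q. is_path (P @ Q) \<and> height (final (P @ Q)) = 0"
    if "is_path P" "spot_of (final P) = NE" "row (final P) = int k" for P k
    using that
  proof (induction k arbitrary: P)
    case 0
    let ?Q = "[arc_from (final P) D]"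
    have "is_path (P @ ?Q)" using 0 by (intro is_path_extend) auto
    moreover have "height (final (P @ ?Q)) = 0"
      using 0 by (simp add: height_eq tgt_arc_from)
    ultimately show ?case by blast
  next
    case (Suc k)
    let ?P' = "P @ [arc_from (final P) D]"
    let ?P'' = "?P' @ [arc_from (final ?P') Db]"
    have 1: "is_path ?P'" using Suc.prems by (intro is_path_extend) auto
    have "is_path ?P''" using Suc.prems
      by (intro is_path_extend 1) (simp_all add: tgt_arc_from)
    moreover have "spot_of (final ?P'') = NE" "row (final ?P'') = int k"
      using Suc.prems by (simp_all only: final_snoc tgt_arc_from) simp_all
    ultimately obtain Q where "is_path (?P'' @ Q) \<and> height (final (?P'' @ Q)) = 0"
      using Suc.IH by blast
    then show ?case by (metis append.assoc)
  qed
  have row: "row (final P) \<ge> 0"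
    using is_path_final_in_quadrant[OF assms] height_nonneg_iff by blast
  show ?thesis
  proof (cases "spot_of (final P)")
    case NE
    then show ?thesis using ne[OF assms] row zero_le_imp_eq_int by blast
  next
    case NW
    let ?P' = "P @ [arc_from (final P) F]"
    have "is_path ?P'" using NW assms row by (intro is_path_extend) auto
    moreover have "spot_of (final ?P') = NE" "row (final ?P') = row (final P)"
      by (simp_all add: tgt_arc_from)
    ultimately obtain Q where "is_path (?P' @ Q) \<and> height (final (?P' @ Q)) = 0"
      using ne row zero_le_imp_eq_int by metis
    then show ?thesis by (metis append.assoc)
  next
    case West
    show ?thesis
    proof (cases "row (final P) = 0")
      case True
      then have "is_path (P @ []) \<and> height (final (P @ [])) = 0"
        using assms West by (simp add: height_eq)
      then show ?thesis by blast
    next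
      case False
      let ?P' = "P @ [arc_from (final P) Db]"
      have "is_path ?P'" using West assms row False by (intro is_path_extend) auto
      moreover have "spot_of (final ?P') = NE" "row (final ?P') = int (nat (row (final P) - 1))"
        using row False by (simp_all add: tgt_arc_from)
      ultimately obtain Q where "is_path (?P' @ Q) \<and> height (final (?P' @ Q)) = 0"
        using ne by blast
      then show ?thesis by (metis append.assoc)
    qed
  qed
qed

lemma is_path_prefix: "is_path (P @ Q) \<Longrightarrow> is_path P"
proof (induction Q rule: rev_induct)
  case (snoc a Q)
  then show ?case using is_path_snoc[of "P @ Q" a] by simp
qed simp

lemma partial_packing_path_iff: "partial_packing_path P \<longleftrightarrow> is_path P"
proof
  assume "partial_packing_path P"
  then show "is_path P"
    unfolding partial_packing_path_def packing_path_def using is_path_prefix by blast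
next
  assume "is_path P"
  then obtain Q where "is_path (P @ Q)" "height (final (P @ Q)) = 0"
    using is_path_extends_to_axis by blast
  then show "partial_packing_path P"
    unfolding partial_packing_path_def packing_path_def endpoint_eq pos_def by auto
qed

section \<open>Counting paths by their last vertex\<close>

definition paths :: "nat \<Rightarrow> spot \<Rightarrow> int \<Rightarrow> arc list set" where
  "paths n w j = {P. is_path P \<and> length P = n \<and> spot_of (final P) = w \<and> row (final P) = j}"

lemma paths_neg: "j < 0 \<Longrightarrow> paths n w j = {}"
  using is_path_final_in_quadrant height_nonneg_iff by (fastforce simp: paths_def)

lemma paths_0: "paths 0 w j = (if w = West \<and> j = 0 then {[]} else {})"
  by (auto simp: paths_def spot_of_def row_def)

definition extend :: "step \<Rightarrow> arc list \<Rightarrow> arc list" where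
  "extend s P = P @ [arc_from (final P) s]"

lemma inj_extend: "inj_on (extend s) A"
  by (auto simp: inj_on_def extend_def)

text \<open>The last arc is split off. For \<open>j = -1\<close> the right-hand side could still
  contain \<open>Db\<close>-extensions of paths in row 0, which leave the quadrant.\<close>

lemma paths_Suc:
  assumes "j \<ge> 0"
  shows "paths (Suc n) w j =
    (\<Union>s\<in>{s. tgt_spot s = w}. extend s ` paths n (src_spot s) (j - row_shift s))"
proof (intro equalityI subsetI)
  fix P assume P: "P \<in> paths (Suc n) w j"
  then have "P \<noteq> []" by (auto simp: paths_def)
  then obtain P' a where Pa: "P = P' @ [a]" by (meson rev_exhaust)
  then have a: "is_path P'" "src a = final P'" using P by (auto simp: paths_def is_path_snoc)
  then obtain s where s: "spot_of (final P') = src_spot s" "a = arc_from (final P') s"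
    unfolding src_eq_iff by blast
  then have "tgt_spot s = w" "P' \<in> paths n (src_spot s) (j - row_shift s)" "P = extend s P'"
    using P a by (auto simp: paths_def Pa tgt_arc_from extend_def)
  then show "P \<in> (\<Union>s\<in>{s. tgt_spot s = w}. extend s ` paths n (src_spot s) (j - row_shift s))"
    by blast
next
  fix P assume "P \<in> (\<Union>s\<in>{s. tgt_spot s = w}. extend s ` paths n (src_spot s) (j - row_shift s))"
  then show "P \<in> paths (Suc n) w j"
    using assms by (auto simp: paths_def extend_def tgt_arc_from intro!: is_path_extend)
qed

lemma tgt_spot_vimage:
  "{s. tgt_spot s = West} = {D, Ub}" "{s. tgt_spot s = NW} = {U, Fb}" "{s. tgt_spot s = NE} = {F, Db}"
  by (auto elim: tgt_spot.elims)

lemma finite_steps: "finite {s. tgt_spot s = w}"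
  by (cases w) (simp_all add: tgt_spot_vimage)

lemma finite_paths: "finite (paths n w j)"
proof (induction n arbitrary: w j)
  case (Suc n)
  then show ?case
    by (cases "j < 0") (simp_all add: paths_neg paths_Suc finite_steps)
qed (simp add: paths_0)

text \<open>The last arc records its step, so the union over the steps is disjoint.\<close>

lemma card_paths_Suc:
  assumes "j \<ge> 0"
  shows "card (paths (Suc n) w j) =
    (\<Sum>s | tgt_spot s = w. card (paths n (src_spot s) (j - row_shift s)))"
proof -
  have "extend s ` A \<inter> extend t ` B = {}" if "s \<noteq> t" for s t A B
    using that by (auto simp: extend_def) (metis arc_from_step)
  then show ?thesis unfolding paths_Suc[OF assms]
    by (subst card_UN_disjoint) (simp_all add: finite_steps finite_paths card_image inj_extend)
qed

lemmas card_paths_step = card_paths_Suc[of _ _ West, unfolded tgt_spot_vimage]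
  card_paths_Suc[of _ _ NW, unfolded tgt_spot_vimage]
  card_paths_Suc[of _ _ NE, unfolded tgt_spot_vimage]

section \<open>From heights to kinds and rows\<close>

lemma num_partial_paths: "num_partial n k = card {P. is_path P \<and> length P = n \<and> height (final P) = int k}"
proof -
  have "of_int h * sqrt 3 = real k * sqrt 3 \<longleftrightarrow> h = int k" for h by auto
  then show ?thesis by (simp add: num_partial_def partial_packing_path_iff endpoint_eq pos_def)
qed

lemma num_partial_even: "num_partial n (2 * k) = card (paths n West (int k))"
proof -
  have "height v = int (2 * k) \<longleftrightarrow> spot_of v = West \<and> row v = int k" for v
    unfolding height_eq by (auto; presburger)
  then show ?thesis by (simp only: num_partial_paths paths_def)
qed

lemma num_partial_odd:
  "num_partial n (2 * k + 1) = card (paths n NW (int k)) + card (paths n NE (int k))"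
proof -
  have "height v = int (2 * k + 1) \<longleftrightarrow> (spot_of v = NW \<or> spot_of v = NE) \<and> row v = int k" for v
    unfolding height_eq by (cases "spot_of v") (auto; presburger)+
  then have "num_partial n (2 * k + 1) = card (paths n NW (int k) \<union> paths n NE (int k))"
    unfolding num_partial_paths paths_def by (intro arg_cong[where f = card]) auto
  also have "\<dots> = card (paths n NW (int k)) + card (paths n NE (int k))"
    by (intro card_Un_disjoint finite_paths) (auto simp: paths_def)
  finally show ?thesis .
qed

section \<open>Generating functions\<close>

text \<open>The hypotheses are the recurrences for the columns \<open>\<alpha> * h ^ k\<close>,
  \<open>\<beta> * h ^ k\<close>, \<open>\<gamma> * h ^ k\<close> with the common power of
  \<open>h\<close> removed: \<open>West\<close> in row 0, \<open>West\<close> in higher rows,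
  \<open>NW\<close>, \<open>NE\<close>. Each recurrence carries a factor \<open>fps_X\<close>, so
  induction on the length applies.\<close>

lemma card_paths_fps:
  fixes \<alpha> \<beta> \<gamma> h :: "real fps"
  assumes \<alpha>: "\<alpha> = 1 + fps_X * \<gamma>"
    and \<alpha>': "\<alpha> * h = fps_X * (\<gamma> * h + \<beta>)"
    and \<beta>: "\<beta> = fps_X * (\<alpha> + \<gamma>)"
    and \<gamma>: "\<gamma> = fps_X * (\<alpha> * h + \<beta>)"
  shows "real (card (paths n w (int k))) =
    fps_nth ((case w of West \<Rightarrow> \<alpha> | NW \<Rightarrow> \<beta> | NE \<Rightarrow> \<gamma>) * h ^ k) n"
proof (induction n arbitrary: w k)
  case 0
  \<comment> \<open>The equations force \<open>h $ 0 = 0\<close>, so the empty path is counted only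
    for \<open>k = 0\<close>.\<close>
  have "\<beta> $ 0 = 0" "\<gamma> $ 0 = 0" by (subst \<beta> \<gamma>, simp)+
  moreover from this have "h $ 0 = 0"
    using arg_cong[OF \<alpha>', of "\<lambda>f. f $ 0"] arg_cong[OF \<alpha>, of "\<lambda>f. f $ 0"] by simp
  moreover have "\<alpha> $ 0 = 1" by (subst \<alpha>) simp
  ultimately show ?case
    by (cases w) (auto simp: paths_0 fps_power_zeroth)
next
  case (Suc n)
  have shift: "int k + 1 = int (Suc k)" by simp
  show ?case
  proof (cases w)
    case West
    show ?thesis
    proof (cases k)
      case 0
      \<comment> \<open>Row -1 is empty, so on the axis \<open>Ub\<close> contributes nothing and
        only \<open>D\<close> remains.\<close>
      have "\<alpha> $ Suc n = \<gamma> $ n" by (subst \<alpha>) simp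
      then show ?thesis
        using Suc.IH[of NE 0] by (simp add: West 0 card_paths_step paths_neg)
    next
      case (Suc k')
      have "\<alpha> * h ^ k = fps_X * (\<gamma> * h ^ k + \<beta> * h ^ k')"
        using arg_cong[OF \<alpha>', of "\<lambda>f. f * h ^ k'"] by (simp add: Suc algebra_simps)
      then show ?thesis
        using Suc.IH[of NE k] Suc.IH[of NW k'] by (simp add: West Suc card_paths_step)
    qed
  next
    case NW
    have "\<beta> * h ^ k = fps_X * (\<alpha> * h ^ k + \<gamma> * h ^ k)"
      by (subst \<beta>) (simp add: algebra_simps)
    then show ?thesis
      using Suc.IH[of West k] Suc.IH[of NE k] by (simp add: NW card_paths_step)
  next
    case NE
    have "\<gamma> * h ^ k = fps_X * (\<alpha> * h ^ Suc k + \<beta> * h ^ k)"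
      by (subst \<gamma>) (simp add: algebra_simps)
    then show ?thesis
      using Suc.IH[of West "Suc k"] Suc.IH[of NW k]
      by (simp add: NE card_paths_step shift del: of_nat_Suc power_Suc)
  qed
qed

text \<open>Multiplying by the conjugate \<open>1 - X + R\<close>, which is a unit, exhibits the divisibility by \<open>X\<^sup>3\<close>.\<close>

lemma sqrt_numerator_factors:
  fixes R X :: "real fps"
  assumes X: "X = fps_X"
    and R2: "R ^ 2 = 1 - 2 * X + X^2 - 4 * X^3 + 4 * X^4" and R0: "R $ 0 = 1"
  obtains \<delta> :: "real fps"
  where "1 - X - R = 2 * X^3 * (1 + X^3 * \<delta>)" "(1 - X) * \<delta> = (1 + X^3 * \<delta>)^2"
proof -
  define I where "I = inverse (1 - X + R)"
  have I: "(1 - X + R) * I = 1"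
    unfolding I_def by (rule inverse_mult_eq_1') (simp add: X R0)
  define J where "J = inverse (1 - X)"
  have J: "(1 - X) * J = 1"
    unfolding J_def by (rule inverse_mult_eq_1') (simp add: X)
  \<comment> \<open>Chosen because \<open>(1 - X)^2 - R^2 = 4 * X^3 * (1 - X)\<close>.\<close>
  define \<alpha> where "\<alpha> = 2 * (1 - X) * I"
  have 1: "1 - X - R = 2 * X^3 * \<alpha>"
    using I R2 unfolding \<alpha>_def by algebra
  have "4 * X^3 * ((1 - X) * (\<alpha> - 1)) = 4 * X^3 * (X^3 * \<alpha>^2)"
    using 1 R2 by algebra
  moreover have "4 * X^3 \<noteq> 0" by (simp add: X)
  ultimately have "(1 - X) * (\<alpha> - 1) = X^3 * \<alpha>^2" by simp
  \<comment> \<open>Dividing the quadratic by the unit \<open>1 - X\<close> shows that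
    \<open>\<alpha> - 1\<close> is a multiple of \<open>X^3\<close>.\<close>
  with J have 2: "\<alpha> = 1 + X^3 * (\<alpha>^2 * J)" by algebra
  show ?thesis
  proof (rule that[of "\<alpha>^2 * J"])
    show "1 - X - R = 2 * X^3 * (1 + X^3 * (\<alpha>^2 * J))" using 1 2 by simp
    show "(1 - X) * (\<alpha>^2 * J) = (1 + X^3 * (\<alpha>^2 * J))^2" using J 2 by algebra
  qed
qed

theorem theorem6:
  fixes p R X :: "real fps"
  defines "X \<equiv> fps_X"
  defines "p \<equiv> 1 - 2 * X + X^2 - 4 * X^3 + 4 * X^4"
  defines "R \<equiv> fps_radical root 2 p"
  shows "is_riordan_array S_even
           ((1 - X - R) / (2 * X^3))
           ((1 - X^2 * (1 + 2 * X) - (1 + X) * R) / (2 * X^3))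
       \<and> is_riordan_array S_odd
           ((1 - 3 * X^3 - 2 * X^4 - (1 + X + X^2) * R) / (2 * X^5))
           ((1 - X^2 - 2 * X^3 - (1 + X) * R) / (2 * X^3))"
proof -
  have p0: "p $ 0 = 1" by (simp add: p_def X_def)
  have "R ^ 2 = p"
    using power_radical[of p root 1] p0 by (simp add: R_def numeral_2_eq_2)
  then have R2: "R ^ 2 = 1 - 2 * X + X^2 - 4 * X^3 + 4 * X^4"
    by (simp add: p_def)
  have R0: "R $ 0 = 1" by (simp add: R_def p0)
  obtain \<delta> where R: "1 - X - R = 2 * X^3 * (1 + X^3 * \<delta>)"
    and \<delta>: "(1 - X) * \<delta> = (1 + X^3 * \<delta>)^2"
    using sqrt_numerator_factors[OF X_def[THEN meta_eq_to_obj_eq] R2 R0] by blast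
  \<comment> \<open>These are the series of row 0: \<open>\<alpha>\<close> for \<open>West\<close>,
    \<open>\<gamma>\<close>, that is \<open>(\<alpha> - 1) / X\<close>, for \<open>NE\<close>, and
    \<open>f\<close> for \<open>NW\<close>. Writing them with \<open>\<delta>\<close> avoids
    division by \<open>X\<close>.\<close>
  define \<alpha> \<gamma> f where "\<alpha> = 1 + X^3 * \<delta>" and "\<gamma> = X^2 * \<delta>" and "f = (1 + X) * \<alpha> - 1"
  \<comment> \<open>This is \<open>(f + \<gamma>) / X\<close>, the series of height 1 shifted by one
    step.\<close>
  define g where "g = 1 + X * (1 + X + X^2) * \<delta>"
  have ne: "2 * X^3 \<noteq> 0" "2 * X^5 \<noteq> 0" by (simp_all add: X_def)
  have R': "R = 1 - X - 2 * X^3 * \<alpha>" using R unfolding \<alpha>_def by algebra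
  have "1 - X - R = \<alpha> * (2 * X^3)" unfolding R' by algebra
  then have g_even: "(1 - X - R) / (2 * X^3) = \<alpha>" using ne by simp
  have "1 - X^2 * (1 + 2 * X) - (1 + X) * R = f * (2 * X^3)"
    unfolding R' f_def by algebra
  then have f_even: "(1 - X^2 * (1 + 2 * X) - (1 + X) * R) / (2 * X^3) = f" using ne by simp
  have "1 - X^2 - 2 * X^3 - (1 + X) * R = f * (2 * X^3)"
    unfolding R' f_def by algebra
  then have f_odd: "(1 - X^2 - 2 * X^3 - (1 + X) * R) / (2 * X^3) = f" using ne by simp
  have "1 - 3 * X^3 - 2 * X^4 - (1 + X + X^2) * R = g * (2 * X^5)"
    unfolding R' g_def \<alpha>_def by algebra
  then have g_odd: "(1 - 3 * X^3 - 2 * X^4 - (1 + X + X^2) * R) / (2 * X^5) = g" using ne by simp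
  have count: "real (card (paths n w (int k))) =
      fps_nth ((case w of West \<Rightarrow> \<alpha> | NW \<Rightarrow> f | NE \<Rightarrow> \<gamma>) * (X * f) ^ k) n" for n w k
  proof (rule card_paths_fps, fold X_def)
    show "\<alpha> = 1 + X * \<gamma>" unfolding \<alpha>_def \<gamma>_def by algebra
    then show "\<alpha> * (X * f) = X * (\<gamma> * (X * f) + f)" by algebra
    show "f = X * (\<alpha> + \<gamma>)" unfolding f_def \<alpha>_def \<gamma>_def by algebra
    \<comment> \<open>The quadratic equation for \<open>\<delta>\<close> enters here; the other
      three recurrences hold by the choice of the series.\<close>
    show "\<gamma> = X * (\<alpha> * (X * f) + f)" using \<delta> unfolding f_def \<alpha>_def \<gamma>_def by algebra
  qed
  \<comment> \<open>Successive columns have ratio \<open>X * f\<close>; reading the coefficient at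
    \<open>n + k\<close> cancels \<open>X ^ k\<close> and leaves the Riordan ratio
    \<open>f\<close>.\<close>
  have shift: "fps_nth (u * (X * f) ^ k) (n + k) = fps_nth (u * f ^ k) n" for u n k
  proof -
    have "u * (X * f) ^ k = X ^ k * (u * f ^ k)" by (simp add: power_mult_distrib mult_ac)
    then show ?thesis by (simp only: X_def fps_X_power_mult_nth) simp
  qed
  have "S_even = riordan_array \<alpha> f"
    by (intro ext) (simp add: S_even_def num_partial_even count shift riordan_array_def)
  moreover have "S_odd = riordan_array g f"
  proof (intro ext)
    fix n k
    have "f + \<gamma> = X * g"
      unfolding f_def \<alpha>_def \<gamma>_def g_def by algebra
    have "S_odd n k = fps_nth ((f + \<gamma>) * (X * f) ^ k) (n + k + 1)"
      by (simp add: S_odd_def num_partial_odd[simplified] count distrib_right)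
    also have "\<dots> = fps_nth (X * (g * (X * f) ^ k)) (n + k + 1)"
      unfolding \<open>f + \<gamma> = X * g\<close> by (simp only: mult.assoc)
    also have "\<dots> = riordan_array g f n k"
      using shift[of g k n] by (simp add: X_def riordan_array_def)
    finally show "S_odd n k = riordan_array g f n k" .
  qed
  moreover have "\<alpha> $ 0 \<noteq> 0" "g $ 0 \<noteq> 0" "f $ 0 = 0" "f $ 1 \<noteq> 0"
    by (simp_all add: \<alpha>_def g_def f_def X_def mult.assoc fps_X_power_mult_nth distrib_right)
  ultimately show ?thesis
    unfolding g_even f_even g_odd f_odd is_riordan_array_def by blast
qed

end
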